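(* Let $k,d \ge 2$ be integers. There exists a mixture of $k$ Gaussians in $\mathbb{R}^d$ whose density has at least $\binom{k}{d}+k$ modes. That is, $m(d,k)\geq \binom{k}{d}+k$.
   Context: The density of the Gaussian distribution $N(\mu,\Sigma)$ on $\mathbb{R}^d$, with mean $\mu\in\mathbb{R}^d$ and symmetric positive definite covariance matrix $\Sigma\in\mathbb{R}^{d\times d}$, is $\phi_{\mu,\Sigma}(x)=\frac{1}{\sqrt{\det(2\pi\Sigma)}}\,e^{-\frac12 (x-\mu)^T\Sigma^{-1}(x-\mu)}$. A mixture of $k$ Gaussians in $\mathbb{R}^d$ has density $\Phi(x)=\sum_{i=1}^k\alpha_i\,\phi_{\mu_i,\Sigma_i}(x)$, where $\alpha_i\ge 0$, $\alpha_1+\cdots+\alpha_k=1$, $\mu_i\in\mathbb{R}^d$, and each $\Sigma_i$ is symmetric positive definite (the means, covariances and weights are otherwise arbitrary). A mode of the mixture is a point of $\mathbb{R}^d$ at which $\Phi$ has a local maximum. $m(d,k)$ denotes the maximal number (supremum, possibly infinite a priori) of modes over all mixtures of $k$ Gaussians in $\mathbb{R}^d$. The binomial coefficient $\binom{k}{d}$ is $0$ when $k<d$. *)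

theory Defs
  imports "HOL-Analysis.Analysis"
begin

definition sym_pos_def :: "real^'d^'d \<Rightarrow> bool" where
  "sym_pos_def S \<longleftrightarrow> transpose S = S \<and> (\<forall>x. x \<noteq> 0 \<longrightarrow> x \<bullet> (S *v x) > 0)"

definition gaussian_density :: "real^'d \<Rightarrow> real^'d^'d \<Rightarrow> real^'d \<Rightarrow> real" where
  "gaussian_density \<mu> S x =
     1 / sqrt (det ((2 * pi) *\<^sub>R S)) * exp (- (1/2) * ((x - \<mu>) \<bullet> (matrix_inv S *v (x - \<mu>))))"

(* The k components are indexed by 0, ..., k-1; values of the parameters at
   indices >= k are irrelevant. *)
definition mixture_params ::
  "nat \<Rightarrow> (nat \<Rightarrow> real) \<Rightarrow> (nat \<Rightarrow> real^'d) \<Rightarrow> (nat \<Rightarrow> real^'d^'d) \<Rightarrow> bool" where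
  "mixture_params k \<alpha> \<mu> S \<longleftrightarrow>
     (\<forall>i<k. \<alpha> i \<ge> 0) \<and> (\<Sum>i<k. \<alpha> i) = 1 \<and> (\<forall>i<k. sym_pos_def (S i))"

definition mixture_density ::
  "nat \<Rightarrow> (nat \<Rightarrow> real) \<Rightarrow> (nat \<Rightarrow> real^'d) \<Rightarrow> (nat \<Rightarrow> real^'d^'d) \<Rightarrow> real^'d \<Rightarrow> real" where
  "mixture_density k \<alpha> \<mu> S x = (\<Sum>i<k. \<alpha> i * gaussian_density (\<mu> i) (S i) x)"

(* Local maxima need not be strict. *)
definition modes :: "('a::topological_space \<Rightarrow> real) \<Rightarrow> 'a set" where
  "modes f = {x. \<forall>\<^sub>F y in nhds x. f y \<le> f x}"

definition num_modes :: "('a::topological_space \<Rightarrow> real) \<Rightarrow> enat" where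
  "num_modes f = (if finite (modes f) then enat (card (modes f)) else \<infinity>)"

(* m(d,k), where d = CARD('d) is passed through the type argument. *)
definition max_modes :: "'d::finite itself \<Rightarrow> nat \<Rightarrow> enat" where
  "max_modes _ k =
     Sup {num_modes (mixture_density k \<alpha> \<mu> S) | \<alpha> (\<mu> :: nat \<Rightarrow> real^'d) S. mixture_params k \<alpha> \<mu> S}"

end

theory Submission
  imports Defs
begin

text \<open>
  Write \<open>d\<close> for the dimension. Take \<open>k\<close> hyperplanes \<open>H\<^sub>i\<close> in general position: any \<open>d\<close> of
  them meet in a single point, a vertex, which lies on no other hyperplane. On each \<open>H\<^sub>i\<close> fix a
  centre \<open>\<mu>\<^sub>i\<close> that lies on no other hyperplane. Component \<open>i\<close> of the mixture has mean \<open>\<mu>\<^sub>i\<close>, is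
  squeezed towards \<open>H\<^sub>i\<close> by a large precision \<open>s\<close> in the normal direction, and has a small
  precision \<open>\<delta>\<close> in the other directions. The weights are chosen so that all components have the
  same peak height, say 1. Each component is then a long, nearly level ridge along \<open>H\<^sub>i\<close>.

  At a vertex, \<open>d\<close> ridges of height almost 1 are superposed, while a nearby point lies on at most
  \<open>d - 1\<close> of them; so the density has a local maximum close to every vertex. At a centre \<open>\<mu>\<^sub>i\<close> there
  is only the ridge along \<open>H\<^sub>i\<close>, and this ridge has a strict peak at \<open>\<mu>\<^sub>i\<close>; so there is a local
  maximum close to every centre. This yields \<open>(k choose d) + k\<close> modes, and they are different
  because they lie in disjoint balls.

  To make this precise, \<open>\<delta>\<close> is fixed first, and then \<open>s\<close> tends to infinity. The sum of the ridges
  decreases pointwise to the function that at \<open>x\<close> counts only the hyperplanes through \<open>x\<close>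
  (\<open>ridge_sum_tendsto_ridge_limit\<close>). For this limit the comparison above is a matter of counting
  (\<open>ridge_limit_strict_peak\<close>). By a Dini-type argument (\<open>eventually_below_on_compact\<close>) the strict
  inequality carries over to large finite \<open>s\<close>, uniformly on a small sphere around each vertex and
  each centre, and this forces a local maximum inside the sphere (\<open>many_modes_of_ridge_sum\<close>).

  The hyperplanes come from polynomials. Identify \<open>x\<close> with the monic polynomial of degree \<open>d\<close>
  whose lower coefficients are the coordinates of \<open>x\<close>, and let \<open>H\<^sub>i\<close> be the set of polynomials that
  vanish at \<open>i\<close>. The vertex of a set \<open>I\<close> of \<open>d\<close> indices is the product of the factors \<open>X - i\<close> with
  \<open>i \<in> I\<close>, and \<open>(X - i)\<^sup>d\<close> serves as the centre on \<open>H\<^sub>i\<close> (\<open>hyperplanes_in_general_position\<close>).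
\<close>

section \<open>Locating local maxima\<close>

text \<open>
  A maximum over the closed ball cannot be attained on the sphere, so it is attained in the
  interior and is a local maximum of the function on the whole space.
\<close>

lemma ball_contains_mode:
  fixes F :: "'a::euclidean_space \<Rightarrow> real"
  assumes "continuous_on UNIV F" and "r > 0" and "\<And>y. y \<in> sphere p r \<Longrightarrow> F y < F p"
  shows "\<exists>z\<in>ball p r. z \<in> modes F"
proof -
  have "continuous_on (cball p r) F"
    using assms(1) continuous_on_subset by blast
  then obtain z where z: "z \<in> cball p r" "\<And>y. y \<in> cball p r \<Longrightarrow> F y \<le> F z"
    using continuous_attains_sup[of "cball p r" F] assms(2) by auto
  have "F p \<le> F z"
    using z(2) assms(2) by simp
  with assms(3)[of z] z(1) have "z \<in> ball p r"
    by fastforce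
  moreover have "\<forall>\<^sub>F y in nhds z. F y \<le> F z"
    unfolding eventually_nhds using \<open>z \<in> ball p r\<close> z(2) by (intro exI[of _ "ball p r"]) auto
  ultimately show ?thesis
    unfolding modes_def by blast
qed

text \<open>
  The modes found for different points of \<open>V\<close> are different because the open balls of radius \<open>r\<close>
  are disjoint.
\<close>

lemma card_le_num_modes:
  fixes F :: "'a::euclidean_space \<Rightarrow> real"
  assumes "continuous_on UNIV F" and "r > 0"
    and sep: "\<And>p q. p \<in> V \<Longrightarrow> q \<in> V \<Longrightarrow> p \<noteq> q \<Longrightarrow> 2 * r \<le> dist p q"
    and peak: "\<And>p y. p \<in> V \<Longrightarrow> y \<in> sphere p r \<Longrightarrow> F y < F p"
  shows "enat (card V) \<le> num_modes F"
proof -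
  have "\<exists>z\<in>ball p r. z \<in> modes F" if "p \<in> V" for p
    using ball_contains_mode[of F r p] assms(1,2) peak[OF that] by blast
  then obtain z where z: "\<And>p. p \<in> V \<Longrightarrow> z p \<in> ball p r" "\<And>p. p \<in> V \<Longrightarrow> z p \<in> modes F"
    by metis
  have "inj_on z V"
  proof (rule inj_onI, rule ccontr)
    fix p q assume pq: "p \<in> V" "q \<in> V" "z p = z q" "p \<noteq> q"
    have "dist p q \<le> dist p (z p) + dist q (z p)"
      by (metis dist_commute dist_triangle)
    moreover have "dist p (z p) < r" "dist q (z p) < r"
      using z(1)[OF pq(1)] z(1)[OF pq(2)] pq(3) by auto
    ultimately show False
      using sep[OF pq(1,2,4)] by linarith
  qed
  then have "card V \<le> card (modes F)" if "finite (modes F)"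
    using that z(2) by (metis card_inj_on_le image_subsetI)
  then show ?thesis
    unfolding num_modes_def by simp
qed

lemma modes_scale:
  fixes F :: "'a::topological_space \<Rightarrow> real"
  assumes "c > 0"
  shows "modes (\<lambda>x. c * F x) = modes F"
  using assms by (simp add: modes_def)

lemma num_modes_scale:
  fixes F :: "'a::topological_space \<Rightarrow> real"
  assumes "c > 0"
  shows "num_modes (\<lambda>x. c * F x) = num_modes F"
  using assms by (simp add: num_modes_def modes_scale)

text \<open>
  A one-sided version of Dini's theorem. Each point of \<open>K\<close> has a neighbourhood on which some
  \<open>F m\<close> is already below \<open>A\<close>; finitely many of these neighbourhoods cover \<open>K\<close>, and by
  monotonicity every later \<open>F m\<close> is below \<open>A\<close> on all of them.
\<close>

lemma eventually_below_on_compact: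
  fixes F :: "nat \<Rightarrow> 'a::topological_space \<Rightarrow> real"
  assumes "compact K" and cont: "\<And>m. continuous_on UNIV (F m)"
    and decr: "\<And>x. decseq (\<lambda>m. F m x)"
    and lim: "\<And>x. x \<in> K \<Longrightarrow> (\<lambda>m. F m x) \<longlonglongrightarrow> G x"
    and less: "\<And>x. x \<in> K \<Longrightarrow> G x < A"
  shows "\<forall>\<^sub>F m in sequentially. \<forall>x\<in>K. F m x < A"
proof -
  have "open {x. F m x < A}" for m
    by (intro open_Collect_less cont continuous_on_const)
  moreover have "K \<subseteq> (\<Union>m\<in>UNIV. {x. F m x < A})"
  proof
    fix x assume "x \<in> K"
    then have "\<forall>\<^sub>F m in sequentially. F m x < A"
      using order_tendstoD(2)[OF lim less] by blast
    then show "x \<in> (\<Union>m\<in>UNIV. {x. F m x < A})"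
      using eventually_happens'[OF sequentially_bot] by fastforce
  qed
  ultimately obtain M where M: "finite M" "K \<subseteq> (\<Union>m\<in>M. {x. F m x < A})"
    using compactE_image[OF \<open>compact K\<close>, of UNIV "\<lambda>m. {x. F m x < A}"] by metis
  have "\<forall>\<^sub>F m in sequentially. \<forall>l\<in>M. l \<le> m"
    using M(1) by (simp add: eventually_ball_finite eventually_ge_at_top)
  then show ?thesis
  proof eventually_elim
    case (elim m)
    show ?case
    proof
      fix x assume "x \<in> K"
      then obtain l where l: "l \<in> M" "F l x < A"
        using M(2) by blast
      then show "F m x < A"
        using decseqD[OF decr, of l m x] elim by force
    qed
  qed
qed

section \<open>Ridges along hyperplanes\<close>

text \<open>
  The sum of Gaussian ridges of peak height 1: \<open>s\<close> is the precision across the hyperplanes and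
  \<open>\<delta>\<close> the isotropic precision that bends every ridge down away from its centre.
\<close>

definition ridge_sum ::
  "nat \<Rightarrow> (nat \<Rightarrow> 'a::euclidean_space) \<Rightarrow> (nat \<Rightarrow> real) \<Rightarrow> (nat \<Rightarrow> 'a) \<Rightarrow> real \<Rightarrow> real \<Rightarrow> 'a \<Rightarrow> real" where
  "ridge_sum k n c \<mu> s \<delta> x =
     (\<Sum>i<k. exp (- (1/2) * (s * (n i \<bullet> x - c i)\<^sup>2 + \<delta> * (norm (x - \<mu> i))\<^sup>2)))"

text \<open>
  The pointwise limit of \<open>ridge_sum\<close> as \<open>s \<rightarrow> \<infinity>\<close>.
\<close>

definition ridge_limit ::
  "nat \<Rightarrow> (nat \<Rightarrow> 'a::euclidean_space) \<Rightarrow> (nat \<Rightarrow> real) \<Rightarrow> (nat \<Rightarrow> 'a) \<Rightarrow> real \<Rightarrow> 'a \<Rightarrow> real" where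
  "ridge_limit k n c \<mu> \<delta> x =
     (\<Sum>i\<in>{i. i < k \<and> n i \<bullet> x = c i}. exp (- (1/2) * (\<delta> * (norm (x - \<mu> i))\<^sup>2)))"

lemma continuous_ridge_sum: "continuous_on UNIV (ridge_sum k n c \<mu> s \<delta>)"
  unfolding ridge_sum_def by (intro continuous_intros)

lemma decseq_ridge_sum: "decseq (\<lambda>m. ridge_sum k n c \<mu> (real m) \<delta> x)"
  unfolding ridge_sum_def
  by (intro decseq_SucI sum_mono) (auto simp: mult_right_mono)

lemma ridge_limit_le_ridge_sum: "ridge_limit k n c \<mu> \<delta> x \<le> ridge_sum k n c \<mu> s \<delta> x"
proof -
  have "ridge_limit k n c \<mu> \<delta> x =
      (\<Sum>i\<in>{i. i < k \<and> n i \<bullet> x = c i}.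
         exp (- (1/2) * (s * (n i \<bullet> x - c i)\<^sup>2 + \<delta> * (norm (x - \<mu> i))\<^sup>2)))"
    unfolding ridge_limit_def by (intro sum.cong) auto
  also have "\<dots> \<le> ridge_sum k n c \<mu> s \<delta> x"
    unfolding ridge_sum_def by (intro sum_mono2) auto
  finally show ?thesis .
qed

lemma ridge_sum_tendsto_ridge_limit:
  "(\<lambda>m. ridge_sum k n c \<mu> (real m) \<delta> x) \<longlonglongrightarrow> ridge_limit k n c \<mu> \<delta> x"
proof -
  define h where "h i = exp (- (1/2) * (\<delta> * (norm (x - \<mu> i))\<^sup>2))" for i
  have "(\<lambda>m. exp (- (1/2) * (real m * (n i \<bullet> x - c i)\<^sup>2 + \<delta> * (norm (x - \<mu> i))\<^sup>2)))
      \<longlonglongrightarrow> (if n i \<bullet> x = c i then h i else 0)" for i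
  proof (cases "n i \<bullet> x = c i")
    case True
    then show ?thesis by (simp add: h_def)
  next
    case False
    \<comment> \<open>Away from its hyperplane a ridge decays geometrically in the integer precision \<open>m\<close>.\<close>
    define q where "q = exp (- (1/2) * (n i \<bullet> x - c i)\<^sup>2)"
    have "0 \<le> q" "q < 1"
      using False by (auto simp: q_def)
    then have "(\<lambda>m. q ^ m) \<longlonglongrightarrow> 0"
      by (intro LIMSEQ_realpow_zero)
    then have "(\<lambda>m. q ^ m * h i) \<longlonglongrightarrow> 0"
      by (rule tendsto_mult_left_zero)
    moreover have "q ^ m * h i =
        exp (- (1/2) * (real m * (n i \<bullet> x - c i)\<^sup>2 + \<delta> * (norm (x - \<mu> i))\<^sup>2))" for m
      unfolding q_def h_def exp_of_nat_mult[symmetric] exp_add[symmetric]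
      by (simp add: algebra_simps)
    ultimately show ?thesis
      using False by simp
  qed
  then have "(\<lambda>m. ridge_sum k n c \<mu> (real m) \<delta> x)
      \<longlonglongrightarrow> (\<Sum>i<k. if n i \<bullet> x = c i then h i else 0)"
    unfolding ridge_sum_def by (intro tendsto_sum)
  moreover have "(\<Sum>i<k. if n i \<bullet> x = c i then h i else 0) = ridge_limit k n c \<mu> \<delta> x"
    unfolding ridge_limit_def h_def by (simp add: sum.If_cases Int_def)
  ultimately show ?thesis by simp
qed

text \<open>
  Hyperplanes are closed, so a hyperplane that misses \<open>p\<close> also misses a neighbourhood of \<open>p\<close>.
\<close>

lemma incident_hyperplanes_shrink_nearby:
  fixes n :: "nat \<Rightarrow> 'a::euclidean_space"
  shows "\<forall>\<^sub>F x in nhds p. \<forall>i<k. n i \<bullet> x = c i \<longrightarrow> n i \<bullet> p = c i"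
proof -
  have "\<forall>\<^sub>F x in nhds p. n i \<bullet> x = c i \<longrightarrow> n i \<bullet> p = c i" for i
  proof (cases "n i \<bullet> p = c i")
    case False
    have "open {x. n i \<bullet> x \<noteq> c i}"
      by (intro open_Collect_neq continuous_intros)
    with False show ?thesis
      unfolding eventually_nhds by blast
  qed auto
  then show ?thesis
    using eventually_ball_finite[of "{..<k}" "\<lambda>x i. n i \<bullet> x = c i \<longrightarrow> n i \<bullet> p = c i" "nhds p"]
    unfolding Ball_def lessThan_iff by blast
qed

text \<open>
  The two kinds of points near which modes arise: a vertex is the only common point of the
  hyperplanes through it, and a centre lies on its own hyperplane only.
\<close>

definition vertex_or_centre ::
  "nat \<Rightarrow> (nat \<Rightarrow> 'a::euclidean_space) \<Rightarrow> (nat \<Rightarrow> real) \<Rightarrow> (nat \<Rightarrow> 'a) \<Rightarrow> 'a \<Rightarrow> bool" where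
  "vertex_or_centre k n c \<mu> p \<longleftrightarrow>
     (\<forall>x. x \<noteq> p \<longrightarrow> (\<exists>i<k. n i \<bullet> p = c i \<and> n i \<bullet> x \<noteq> c i)) \<or>
     (\<exists>i<k. p = \<mu> i \<and> (\<forall>j<k. n j \<bullet> p = c j \<longleftrightarrow> j = i))"

text \<open>
  Near a vertex \<open>p\<close>, moving away from \<open>p\<close> leaves at least one hyperplane, which costs a whole
  summand, and each summand is at most 1. Assumption \<open>flat\<close> says that the ridges are so level that
  their centres, which may be far from \<open>p\<close>, reduce the value at \<open>p\<close> by less than 1 in total. Near a
  centre there is at most one summand, and it is strictly smaller away from the centre.
\<close>

lemma ridge_limit_strict_peak:
  fixes n :: "nat \<Rightarrow> 'a::euclidean_space"
  assumes vc: "vertex_or_centre k n c \<mu> p" and "\<delta> > 0"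
    and flat: "real (card {i. i < k \<and> n i \<bullet> p = c i}) - 1 < ridge_limit k n c \<mu> \<delta> p"
    and near: "\<forall>i<k. n i \<bullet> x = c i \<longrightarrow> n i \<bullet> p = c i" and "x \<noteq> p"
  shows "ridge_limit k n c \<mu> \<delta> x < ridge_limit k n c \<mu> \<delta> p"
proof -
  define J where "J y = {i. i < k \<and> n i \<bullet> y = c i}" for y
  have J: "finite (J y)" for y
    by (simp add: J_def)
  have sub: "J x \<subseteq> J p"
    using near by (auto simp: J_def)
  from vc consider (vertex) "\<exists>i<k. n i \<bullet> p = c i \<and> n i \<bullet> x \<noteq> c i"
    | (centre) i where "i < k" "p = \<mu> i" "\<forall>j<k. n j \<bullet> p = c j \<longleftrightarrow> j = i"
    using \<open>x \<noteq> p\<close> unfolding vertex_or_centre_def by blast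
  then show ?thesis
  proof cases
    case vertex
    then have "J x \<subset> J p"
      using sub by (auto simp: J_def)
    then have "card (J x) < card (J p)"
      using J psubset_card_mono by blast
    moreover have "ridge_limit k n c \<mu> \<delta> x \<le> (\<Sum>i\<in>J x. 1)"
      unfolding ridge_limit_def J_def using \<open>\<delta> > 0\<close> by (intro sum_mono) auto
    ultimately show ?thesis
      using flat unfolding J_def[symmetric] by simp
  next
    case (centre i)
    have Jp: "J p = {i}"
      using centre by (auto simp: J_def)
    then have p: "ridge_limit k n c \<mu> \<delta> p = 1"
      using centre(2) unfolding ridge_limit_def J_def[symmetric] by simp
    from sub Jp have "J x = {} \<or> J x = {i}" by (simp add: subset_singleton_iff)
    then show ?thesis
      using centre(2) \<open>x \<noteq> p\<close> \<open>\<delta> > 0\<close> p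
      unfolding ridge_limit_def J_def[symmetric] by auto
  qed
qed

text \<open>
  The parameters are chosen in the order \<open>r\<close>, \<open>\<delta>\<close>, \<open>s\<close>: the radius depends only on the
  hyperplanes and on \<open>V\<close>, the ridges are then made level enough for every point of \<open>V\<close>, and finally
  they are made thin. At the points of \<open>V\<close> themselves the limit is a lower bound for every \<open>s\<close>, so
  that only the spheres need a uniform estimate.
\<close>

lemma many_modes_of_ridge_sum:
  fixes n :: "nat \<Rightarrow> 'a::euclidean_space"
  assumes "finite V" and vc: "\<And>p. p \<in> V \<Longrightarrow> vertex_or_centre k n c \<mu> p"
  shows "\<exists>s \<delta>. s \<ge> 0 \<and> \<delta> > 0 \<and> enat (card V) \<le> num_modes (ridge_sum k n c \<mu> s \<delta>)"
proof -
  have "\<exists>\<rho>>0. \<forall>x. dist x p < \<rho> \<longrightarrow> (\<forall>i<k. n i \<bullet> x = c i \<longrightarrow> n i \<bullet> p = c i)" for p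
    using incident_hyperplanes_shrink_nearby[of k n c p] unfolding eventually_nhds_metric .
  then have "\<exists>\<rho>. \<forall>p. \<rho> p > 0 \<and>
      (\<forall>x. dist x p < \<rho> p \<longrightarrow> (\<forall>i<k. n i \<bullet> x = c i \<longrightarrow> n i \<bullet> p = c i))"
    by (intro choice) blast
  then obtain \<rho> where \<rho>: "\<And>p. \<rho> p > 0"
    "\<And>p x. dist x p < \<rho> p \<Longrightarrow> \<forall>i<k. n i \<bullet> x = c i \<longrightarrow> n i \<bullet> p = c i"
    by blast
  have pos: "\<forall>\<^sub>F t in at_right (0::real). t < e" if "e > 0" for e
    using that by (auto simp: eventually_at_right_field)
  \<comment> \<open>The value 1 for \<open>p = q\<close> is an arbitrary positive bound; for \<open>p \<noteq> q\<close> the balls become disjoint.\<close>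
  have "\<forall>\<^sub>F r in at_right 0. 0 < r \<and> (\<forall>p\<in>V. r < \<rho> p) \<and>
      (\<forall>p\<in>V. \<forall>q\<in>V. r < (if p = q then 1 else dist p q / 2))"
    using \<open>finite V\<close> \<rho>(1)
    by (intro eventually_conj eventually_ball_finite ballI pos) (auto simp: eventually_at_right_less)
  then obtain r where r: "r > 0" "\<And>p. p \<in> V \<Longrightarrow> r < \<rho> p"
    "\<And>p q. p \<in> V \<Longrightarrow> q \<in> V \<Longrightarrow> r < (if p = q then 1 else dist p q / 2)"
    using eventually_happens'[OF trivial_limit_at_right_real] by blast
  have "\<forall>\<^sub>F \<delta> in at_right 0. real (card {i. i < k \<and> n i \<bullet> p = c i}) - 1 < ridge_limit k n c \<mu> \<delta> p" for p
  proof -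
    \<comment> \<open>At \<open>\<delta> = 0\<close> every summand is 1.\<close>
    have "((\<lambda>\<delta>. ridge_limit k n c \<mu> \<delta> p) \<longlongrightarrow>
        (\<Sum>i\<in>{i. i < k \<and> n i \<bullet> p = c i}. exp (- (1/2) * (0 * (norm (p - \<mu> i))\<^sup>2)))) (at_right 0)"
      unfolding ridge_limit_def by (intro tendsto_intros)
    then show ?thesis
      by (rule order_tendstoD) simp
  qed
  then have "\<forall>\<^sub>F \<delta> in at_right 0. 0 < \<delta> \<and>
      (\<forall>p\<in>V. real (card {i. i < k \<and> n i \<bullet> p = c i}) - 1 < ridge_limit k n c \<mu> \<delta> p)"
    using \<open>finite V\<close> by (intro eventually_conj eventually_ball_finite ballI)
      (auto simp: eventually_at_right_less)
  then obtain \<delta> where \<delta>: "\<delta> > 0"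
    "\<And>p. p \<in> V \<Longrightarrow> real (card {i. i < k \<and> n i \<bullet> p = c i}) - 1 < ridge_limit k n c \<mu> \<delta> p"
    using eventually_happens'[OF trivial_limit_at_right_real] by blast
  have "\<forall>\<^sub>F m in sequentially. \<forall>x\<in>sphere p r. ridge_sum k n c \<mu> (real m) \<delta> x < ridge_limit k n c \<mu> \<delta> p"
    if "p \<in> V" for p
  proof (rule eventually_below_on_compact)
    show "ridge_limit k n c \<mu> \<delta> x < ridge_limit k n c \<mu> \<delta> p" if "x \<in> sphere p r" for x
    proof (rule ridge_limit_strict_peak[OF vc \<delta>(1,2) \<rho>(2)])
      have "dist x p = r"
        using that by (simp add: dist_commute)
      then show "dist x p < \<rho> p" "x \<noteq> p"
        using r(1) r(2)[OF \<open>p \<in> V\<close>] by auto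
    qed (rule \<open>p \<in> V\<close>)+
  qed (auto intro: continuous_ridge_sum decseq_ridge_sum ridge_sum_tendsto_ridge_limit)
  then have "\<forall>\<^sub>F m in sequentially. \<forall>p\<in>V. \<forall>x\<in>sphere p r.
      ridge_sum k n c \<mu> (real m) \<delta> x < ridge_limit k n c \<mu> \<delta> p"
    using \<open>finite V\<close> by (simp add: eventually_ball_finite)
  then obtain m where m: "\<And>p x. p \<in> V \<Longrightarrow> x \<in> sphere p r \<Longrightarrow>
      ridge_sum k n c \<mu> (real m) \<delta> x < ridge_limit k n c \<mu> \<delta> p"
    using eventually_happens'[OF sequentially_bot] by blast
  have "enat (card V) \<le> num_modes (ridge_sum k n c \<mu> (real m) \<delta>)"
  proof (rule card_le_num_modes[OF continuous_ridge_sum \<open>r > 0\<close>])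
    show "2 * r \<le> dist p q" if "p \<in> V" "q \<in> V" "p \<noteq> q" for p q
      using r(3)[of p q] that by simp
    show "ridge_sum k n c \<mu> (real m) \<delta> y < ridge_sum k n c \<mu> (real m) \<delta> p"
      if "p \<in> V" "y \<in> sphere p r" for p y
      using m[OF that] ridge_limit_le_ridge_sum by (rule less_le_trans)
  qed
  then show ?thesis
    using \<delta>(1) by (intro exI[of _ "real m"] exI[of _ \<delta>]) simp
qed

section \<open>Gaussian mixtures with prescribed precision matrices\<close>

lemma sym_pos_def_invertible:
  fixes A :: "real^'d^'d"
  assumes "sym_pos_def A"
  shows "invertible A"
proof -
  have "x = 0" if "A *v x = 0" for x
    using assms that unfolding sym_pos_def_def by (metis inner_zero_right less_irrefl)
  then show ?thesis
    by (metis invertible_left_inverse matrix_left_invertible_ker)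
qed

lemma
  fixes A :: "'a::semiring_1^'n^'m"
  assumes "invertible A"
  shows matrix_inv_right: "A ** matrix_inv A = mat 1"
    and matrix_inv_left: "matrix_inv A ** A = mat 1"
  using someI_ex[OF assms[unfolded invertible_def]] unfolding matrix_inv_def by auto

lemma matrix_inv_inv:
  fixes A :: "'a::semiring_1^'n^'n"
  assumes "invertible A"
  shows "matrix_inv (matrix_inv A) = A"
proof -
  have "invertible (matrix_inv A)"
    unfolding invertible_def using matrix_inv_left[OF assms] matrix_inv_right[OF assms] by blast
  then have "matrix_inv A ** matrix_inv (matrix_inv A) = mat 1"
    by (rule matrix_inv_right)
  then have "A ** (matrix_inv A ** matrix_inv (matrix_inv A)) = A"
    by simp
  then show ?thesis
    by (simp add: matrix_mul_assoc matrix_inv_right[OF assms])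
qed

lemma sym_pos_def_matrix_inv:
  fixes A :: "real^'d^'d"
  assumes "sym_pos_def A"
  shows "sym_pos_def (matrix_inv A)"
proof -
  let ?B = "matrix_inv A"
  have inv: "A ** ?B = mat 1" "?B ** A = mat 1"
    using sym_pos_def_invertible[OF assms] by (rule matrix_inv_right matrix_inv_left)+
  have A: "transpose A = A" "\<And>x. x \<noteq> 0 \<Longrightarrow> x \<bullet> (A *v x) > 0"
    using assms by (auto simp: sym_pos_def_def)
  have "transpose ?B ** A = mat 1"
    by (metis A(1) inv(1) matrix_transpose_mul transpose_mat)
  then have "transpose ?B = ?B"
    by (metis inv(1) matrix_mul_assoc matrix_mul_lid matrix_mul_rid)
  moreover have "x \<bullet> (?B *v x) > 0" if "x \<noteq> 0" for x
  proof -
    have x: "x = A *v (?B *v x)"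
      by (simp add: matrix_vector_mul_assoc inv)
    with that have "?B *v x \<noteq> 0"
      by (metis matrix_vector_mult_0_right)
    from A(2)[OF this] show ?thesis
      using x by (metis inner_commute)
  qed
  ultimately show ?thesis
    by (simp add: sym_pos_def_def)
qed

text \<open>
  The segment from the identity to \<open>A\<close> consists of positive definite, hence invertible matrices,
  so the determinant cannot change its sign along it.
\<close>

lemma sym_pos_def_det_pos:
  fixes A :: "real^'d^'d"
  assumes "sym_pos_def A"
  shows "det A > 0"
proof (rule ccontr)
  assume "\<not> det A > 0"
  define P where "P t = t *\<^sub>R A + (1 - t) *\<^sub>R (mat 1 :: real^'d^'d)" for t :: real
  have "continuous_on {0..1} (\<lambda>t. det (P t))"
    unfolding det_def P_def by (auto intro!: continuous_intros)
  moreover have "det (P 1) \<le> 0" "0 \<le> det (P 0)"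
    using \<open>\<not> det A > 0\<close> by (auto simp: P_def)
  ultimately obtain t where t: "0 \<le> t" "t \<le> 1" "det (P t) = 0"
    using IVT2'[of "\<lambda>t. det (P t)" 1 0 0] by auto
  have "sym_pos_def (P t)"
    unfolding sym_pos_def_def
  proof (intro conjI allI impI)
    show "transpose (P t) = P t"
      using assms by (auto simp: sym_pos_def_def P_def transpose_def vec_eq_iff mat_def)
    fix x :: "real^'d" assume "x \<noteq> 0"
    then have pos: "x \<bullet> (A *v x) > 0" "x \<bullet> x > 0"
      using assms by (auto simp: sym_pos_def_def)
    have "x \<bullet> (P t *v x) = t * (x \<bullet> (A *v x)) + (1 - t) * (x \<bullet> x)"
      by (simp add: P_def matrix_vector_mult_add_rdistrib inner_add_right
          scaleR_matrix_vector_assoc[symmetric])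
    moreover have "t * (x \<bullet> (A *v x)) + (1 - t) * (x \<bullet> x) > 0"
      using t pos by (cases "t = 0") (auto intro: add_pos_nonneg)
    ultimately show "x \<bullet> (P t *v x) > 0"
      by simp
  qed
  then have "invertible (P t)"
    by (rule sym_pos_def_invertible)
  then show False
    using t(3) invertible_det_nz by blast
qed

text \<open>
  The peak height of a Gaussian density is \<open>1 / sqrt (det (2\<pi>\<Sigma>))\<close>, so weights proportional to
  \<open>sqrt (det (2\<pi>\<Sigma>\<^sub>i))\<close> make all components equally high. Working with the precision matrices \<open>A i\<close> instead of the covariances keeps the exponents
  explicit.
\<close>

lemma mixture_of_unnormalised_gaussians:
  fixes \<mu> :: "nat \<Rightarrow> real^'d" and A :: "nat \<Rightarrow> real^'d^'d"
  assumes "k > 0" and spd: "\<And>i. sym_pos_def (A i)"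
  shows "\<exists>\<alpha> S C. C > 0 \<and> mixture_params k \<alpha> \<mu> S \<and>
    mixture_density k \<alpha> \<mu> S = (\<lambda>x. C * (\<Sum>i<k. exp (- (1/2) * ((x - \<mu> i) \<bullet> (A i *v (x - \<mu> i))))))"
proof -
  define S where "S i = matrix_inv (A i)" for i
  define w where "w i = sqrt (det ((2 * pi) *\<^sub>R S i))" for i
  define W where "W = (\<Sum>i<k. w i)"
  have S: "sym_pos_def (S i)" for i
    using spd sym_pos_def_matrix_inv by (auto simp: S_def)
  have invS: "matrix_inv (S i) = A i" for i
    using spd by (simp add: S_def matrix_inv_inv sym_pos_def_invertible)
  have "sym_pos_def ((2 * pi) *\<^sub>R S i)" for i
    using S[of i] unfolding sym_pos_def_def
    by (auto simp: transpose_def vec_eq_iff scaleR_matrix_vector_assoc[symmetric])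
  then have w: "w i > 0" for i
    using sym_pos_def_det_pos by (auto simp: w_def)
  then have W: "W > 0"
    unfolding W_def using \<open>k > 0\<close> by (intro sum_pos) auto
  have "(\<Sum>i<k. w i / W) = 1"
    using W by (simp add: W_def flip: sum_divide_distrib)
  then have "mixture_params k (\<lambda>i. w i / W) \<mu> S"
    unfolding mixture_params_def using w W S by (auto intro: less_imp_le)
  moreover have "mixture_density k (\<lambda>i. w i / W) \<mu> S =
      (\<lambda>x. 1 / W * (\<Sum>i<k. exp (- (1/2) * ((x - \<mu> i) \<bullet> (A i *v (x - \<mu> i))))))"
    using w unfolding mixture_density_def gaussian_density_def w_def[symmetric] invS
    by (intro ext) (simp add: sum_distrib_left less_imp_neq[symmetric])
  ultimately show ?thesis
    using W by (intro exI[of _ "\<lambda>i. w i / W"] exI[of _ S] exI[of _ "1 / W"]) simp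
qed

lemma sym_pos_def_ridge_form:
  fixes v :: "real^'d"
  assumes "s \<ge> 0" and "\<delta> > 0"
  shows "\<exists>A. sym_pos_def A \<and> (\<forall>y. y \<bullet> (A *v y) = s * (v \<bullet> y)\<^sup>2 + \<delta> * (norm y)\<^sup>2)"
proof -
  define A :: "real^'d^'d" where "A = (\<chi> i j. s * v $ i * v $ j) + \<delta> *\<^sub>R mat 1"
  have "(\<chi> i j. s * v $ i * v $ j) *v y = (s * (v \<bullet> y)) *\<^sub>R v" for y :: "real^'d"
    by (simp add: vec_eq_iff matrix_vector_mult_def inner_vec_def sum_distrib_left
        sum_distrib_right mult_ac)
  then have form: "y \<bullet> (A *v y) = s * (v \<bullet> y)\<^sup>2 + \<delta> * (norm y)\<^sup>2" for y
    by (simp add: A_def matrix_vector_mult_add_rdistrib scaleR_matrix_vector_assoc[symmetric]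
        inner_add_right power2_norm_eq_inner inner_commute[of y v] power2_eq_square[of "v \<bullet> y"])
  have "transpose A = A"
    by (simp add: A_def transpose_def vec_eq_iff mat_def mult_ac)
  moreover have "s * (v \<bullet> y)\<^sup>2 + \<delta> * (norm y)\<^sup>2 > 0" if "y \<noteq> 0" for y
    using assms that by (intro add_nonneg_pos) auto
  ultimately have "sym_pos_def A"
    unfolding sym_pos_def_def form by blast
  then show ?thesis
    using form by blast
qed

text \<open>
  Because \<open>\<mu> i\<close> lies on the \<open>i\<close>-th hyperplane, both parts of the exponent of a ridge are quadratic
  forms in \<open>x - \<mu> i\<close>.
\<close>

lemma ridge_sum_is_mixture:
  fixes \<mu> :: "nat \<Rightarrow> real^'d"
  assumes "k > 0" "s \<ge> 0" "\<delta> > 0" and on: "\<And>i. n i \<bullet> \<mu> i = c i"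
  shows "\<exists>\<alpha> S C. C > 0 \<and> mixture_params k \<alpha> \<mu> S \<and>
    mixture_density k \<alpha> \<mu> S = (\<lambda>x. C * ridge_sum k n c \<mu> s \<delta> x)"
proof -
  have "\<exists>A. \<forall>i. sym_pos_def (A i) \<and> (\<forall>y. y \<bullet> (A i *v y) = s * (n i \<bullet> y)\<^sup>2 + \<delta> * (norm y)\<^sup>2)"
    by (intro choice allI sym_pos_def_ridge_form assms)
  then obtain A where A: "\<And>i. sym_pos_def (A i)"
    "\<And>i y. y \<bullet> (A i *v y) = s * (n i \<bullet> y)\<^sup>2 + \<delta> * (norm y)\<^sup>2"
    by blast
  have "(\<Sum>i<k. exp (- (1/2) * ((x - \<mu> i) \<bullet> (A i *v (x - \<mu> i))))) = ridge_sum k n c \<mu> s \<delta> x" for x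
    unfolding ridge_sum_def A(2) by (simp add: inner_diff_right on)
  then show ?thesis
    using mixture_of_unnormalised_gaussians[OF \<open>k > 0\<close>, of A \<mu>] A(1) by simp
qed

section \<open>Hyperplanes in general position\<close>

text \<open>
  Evaluation at \<open>t\<close> is an affine function of the lower coefficients of a monic polynomial, so the
  polynomials that vanish at \<open>t\<close> form a hyperplane. The bijection \<open>e\<close> numbers the coordinates,
  as the index type carries no order.
\<close>

lemma poly_coordinates:
  fixes e :: "'d::finite \<Rightarrow> nat"
  assumes e: "bij_betw e UNIV {..<CARD('d)}"
    and Q: "degree Q = CARD('d)" "lead_coeff Q = (1::real)"
  shows "poly Q t = t ^ CARD('d) + (\<chi> j. t ^ e j) \<bullet> (\<chi> j. coeff Q (e j))"
proof -
  have "poly Q t = (\<Sum>i<CARD('d). coeff Q i * t ^ i) + t ^ CARD('d)"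
    using Q by (simp add: poly_altdef lessThan_Suc_atMost[symmetric])
  also have "(\<Sum>i<CARD('d). coeff Q i * t ^ i) = (\<Sum>j\<in>UNIV. coeff Q (e j) * t ^ e j)"
    by (rule sum.reindex_bij_betw[OF e, symmetric])
  finally show ?thesis
    by (simp add: inner_vec_def mult_ac)
qed

text \<open>
  Points are monic polynomials of degree \<open>d = CARD('d)\<close> and the hyperplane with index \<open>i\<close> is the
  condition \<open>Q(i) = 0\<close>. A monic polynomial of degree \<open>d\<close> is determined by its values at \<open>d\<close> points,
  so that the product of \<open>X - i\<close> over \<open>i \<in> I\<close> is the only one that vanishes on the \<open>d\<close>-element set \<open>I\<close>; its roots, and the
  single root of \<open>(X - i)\<^sup>d\<close>, show on which hyperplanes these points lie.
\<close>

lemma hyperplanes_in_general_position: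
  "\<exists>(n :: nat \<Rightarrow> real^'d) c p \<mu>.
     (\<forall>I x. card I = CARD('d) \<longrightarrow> (\<forall>i\<in>I. n i \<bullet> x = c i) \<longrightarrow> x = p I) \<and>
     (\<forall>I i. card I = CARD('d) \<longrightarrow> (n i \<bullet> p I = c i \<longleftrightarrow> i \<in> I)) \<and>
     (\<forall>i j. n j \<bullet> \<mu> i = c j \<longleftrightarrow> j = i)"
proof -
  let ?d = "CARD('d)"
  obtain e :: "'d \<Rightarrow> nat" where e: "bij_betw e UNIV {..<?d}"
    using ex_bij_betw_finite_nat[of "UNIV :: 'd set"] by (auto simp: atLeast0LessThan)
  define point :: "real poly \<Rightarrow> real^'d" where "point Q = (\<chi> j. coeff Q (e j))" for Q
  define n :: "nat \<Rightarrow> real^'d" where "n i = (\<chi> j. real i ^ e j)" for i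
  define c where "c i = - (real i ^ ?d)" for i
  define p where "p I = point (\<Prod>i\<in>I. [:- real i, 1:])" for I
  define \<mu> where "\<mu> i = point ([:- real i, 1:] ^ ?d)" for i
  have on: "n i \<bullet> point Q = c i \<longleftrightarrow> poly Q (real i) = 0"
    if "degree Q = ?d" "lead_coeff Q = 1" for Q i
    using poly_coordinates[OF e that, of "real i"] by (auto simp: n_def c_def point_def)
  have deg: "degree (\<Prod>i\<in>I. [:- real i, 1:]) = ?d" "lead_coeff (\<Prod>i\<in>I. [:- real i, 1:]) = 1"
    if "card I = ?d" for I
    using that by (simp_all only: lead_coeff_prod) (simp_all add: degree_prod_eq_sum_degree)
  have surj: "\<exists>Q. degree Q = ?d \<and> lead_coeff Q = 1 \<and> x = point Q" for x
  proof -
    define R where "R = (\<Sum>j\<in>UNIV. monom (x $ j) (e j))"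
    have less: "e j < ?d" for j
      using e by (auto simp: bij_betw_def)
    have "degree R < ?d"
      unfolding R_def using less
      by (intro degree_sum_less) (auto intro: le_less_trans[OF degree_monom_le])
    then have "degree (monom 1 ?d + R) = ?d" "lead_coeff (monom 1 ?d + R) = 1"
      by (auto simp: degree_add_eq_left degree_monom_eq coeff_eq_0)
    moreover have "coeff R (e j) = x $ j" for j
    proof -
      have "e i = e j \<longleftrightarrow> i = j" for i
        using e by (auto simp: bij_betw_def inj_on_def)
      then show ?thesis
        unfolding R_def coeff_sum by (simp add: coeff_monom)
    qed
    then have "x = point (monom 1 ?d + R)"
      using less by (simp add: point_def vec_eq_iff coeff_monom less_imp_neq[symmetric])
    ultimately show ?thesis by blast
  qed
  have "x = p I" if I: "card I = ?d" "\<forall>i\<in>I. n i \<bullet> x = c i" for I x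
  proof -
    obtain Q where Q: "degree Q = ?d" "lead_coeff Q = 1" "x = point Q"
      using surj by blast
    have "card (real ` I) = ?d"
      using I(1) by (simp add: card_image inj_on_def)
    moreover have "finite I"
      using I(1) by (metis card.infinite zero_less_card_finite less_irrefl)
    ultimately have "Q = (\<Prod>i\<in>I. [:- real i, 1:])"
      using Q deg[OF I(1)] I(2) on[OF Q(1,2)]
      by (intro poly_eqI_degree_lead_coeff[of _ ?d _ "real ` I"]) (auto simp: poly_prod)
    then show ?thesis
      using Q(3) by (simp add: p_def)
  qed
  moreover have "n i \<bullet> p I = c i \<longleftrightarrow> i \<in> I" if "card I = ?d" for I i
  proof -
    have "finite I"
      using that by (metis card.infinite zero_less_card_finite less_irrefl)
    then show ?thesis
      unfolding p_def on[OF deg[OF that]] by (auto simp: poly_prod)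
  qed
  moreover have "n j \<bullet> \<mu> i = c j \<longleftrightarrow> j = i" for i j
  proof -
    have "degree ([:- real i, 1:] ^ ?d) = ?d" "lead_coeff ([:- real i, 1:] ^ ?d) = 1"
      by (simp_all only: lead_coeff_power) (simp_all add: degree_power_eq)
    from on[OF this] show ?thesis
      unfolding \<mu>_def by auto
  qed
  ultimately show ?thesis by blast
qed

section \<open>The lower bound\<close>

theorem theorem6:
  fixes k :: nat
  assumes "k \<ge> 2" and "CARD('d::finite) \<ge> 2"
  shows "(\<exists>\<alpha> (\<mu> :: nat \<Rightarrow> real^'d) S. mixture_params k \<alpha> \<mu> S \<and>
            num_modes (mixture_density k \<alpha> \<mu> S) \<ge> enat ((k choose CARD('d)) + k)) \<and>
         max_modes TYPE('d) k \<ge> enat ((k choose CARD('d)) + k)"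
proof -
  let ?d = "CARD('d)"
  obtain n :: "nat \<Rightarrow> real^'d" and c p \<mu> where
    uniq: "\<And>I x. card I = ?d \<Longrightarrow> \<forall>i\<in>I. n i \<bullet> x = c i \<Longrightarrow> x = p I" and
    p: "\<And>I i. card I = ?d \<Longrightarrow> n i \<bullet> p I = c i \<longleftrightarrow> i \<in> I" and
    \<mu>: "\<And>i j. n j \<bullet> \<mu> i = c j \<longleftrightarrow> j = i"
    using hyperplanes_in_general_position[where ?'d = 'd] by blast
  define Is where "Is = {I. I \<subseteq> {..<k} \<and> card I = ?d}"
  have "finite Is"
    unfolding Is_def by (rule finite_subset[of _ "Pow {..<k}"]) auto
  have "inj_on p Is"
  proof (rule inj_onI)
    fix I J assume "I \<in> Is" "J \<in> Is" "p I = p J"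
    then have "i \<in> I \<longleftrightarrow> i \<in> J" for i
      using p[of I i] p[of J i] by (simp add: Is_def)
    then show "I = J" by blast
  qed
  have "inj_on \<mu> {..<k}"
    using \<mu> by (metis inj_onI)
  have "p ` Is \<inter> \<mu> ` {..<k} = {}"
  proof -
    have "p I \<noteq> \<mu> i" if "card I = ?d" for I i
    proof
      \<comment> \<open>A vertex lies on \<open>d \<ge> 2\<close> of the hyperplanes, a centre on one only.\<close>
      assume "p I = \<mu> i"
      then have "I = {i}"
        using p[OF that] \<mu> by auto
      with that show False
        using assms(2) by simp
    qed
    then show ?thesis by (auto simp: Is_def)
  qed
  define V where "V = p ` Is \<union> \<mu> ` {..<k}"
  have "finite V"
    using \<open>finite Is\<close> by (simp add: V_def)
  have "card V = card Is + k"
    using \<open>finite Is\<close> \<open>p ` Is \<inter> \<mu> ` {..<k} = {}\<close> \<open>inj_on p Is\<close> \<open>inj_on \<mu> {..<k}\<close>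
    by (simp add: V_def card_Un_disjoint card_image)
  also have "card Is = k choose ?d"
    unfolding Is_def using n_subsets[of "{..<k}" ?d] by simp
  finally have card: "card V = (k choose ?d) + k" .
  have "vertex_or_centre k n c \<mu> q" if "q \<in> V" for q
  proof -
    consider I where "I \<subseteq> {..<k}" "card I = ?d" "q = p I" | i where "i < k" "q = \<mu> i"
      using \<open>q \<in> V\<close> by (auto simp: V_def Is_def)
    then show ?thesis
    proof cases
      case (1 I)
      then have "\<exists>i<k. n i \<bullet> q = c i \<and> n i \<bullet> x \<noteq> c i" if "x \<noteq> q" for x
        using that uniq[of I x] p[of I] by blast
      then show ?thesis
        unfolding vertex_or_centre_def by blast
    next
      case (2 i)
      then show ?thesis
        unfolding vertex_or_centre_def using \<mu> by blast
    qed
  qed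
  then obtain s \<delta> where s: "s \<ge> 0" "\<delta> > 0" "enat (card V) \<le> num_modes (ridge_sum k n c \<mu> s \<delta>)"
    using many_modes_of_ridge_sum[OF \<open>finite V\<close>] by blast
  moreover have "k > 0" "\<And>i. n i \<bullet> \<mu> i = c i"
    using assms(1) \<mu> by auto
  ultimately obtain \<alpha> S C where mix: "C > 0" "mixture_params k \<alpha> \<mu> S"
    "mixture_density k \<alpha> \<mu> S = (\<lambda>x. C * ridge_sum k n c \<mu> s \<delta> x)"
    using ridge_sum_is_mixture[of k s \<delta> n \<mu> c] by blast
  have many: "enat ((k choose ?d) + k) \<le> num_modes (mixture_density k \<alpha> \<mu> S)"
    using s(3) card mix(1,3) by (simp add: num_modes_scale)
  also have "\<dots> \<le> max_modes TYPE('d) k"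
    unfolding max_modes_def using mix(2) by (intro Sup_upper) blast
  finally show ?thesis
    using mix(2) many by blast
qed

end
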